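(* In an augmented virtual double category $\mathcal K$ let $j\colon A\to B$, $f\colon A\to C$ and $g\colon B\to C$ be vertical morphisms, where the companion $j_*\colon A\nrightarrow B$ exists, with weakly cocartesian defining cell $\eta_j\colon(A)\Rightarrow j_*$. Let $\psi\colon f\Rightarrow g\circ j$ be a vertical cell and let $\psi'\colon j_*\Rightarrow(C)$, with vertical source $f$ and vertical target $g$, be its factorisation through $\eta_j$, so that $\psi=\psi'\circ\eta_j$. The vertical cell $\psi$ defines $j$ as the absolute left lifting of $f$ along $g$ in the 2-category $V(\mathcal K)$ whenever $\psi'$ is cartesian in $\mathcal K$.
   Context: **Augmented virtual double categories.** An augmented virtual double category $\mathcal K$ consists of: a class of objects; a category $\mathcal K_{\mathrm v}$ with these objects, whose morphisms $f\colon A\to C$ are called vertical; a directed graph $\mathcal K_{\mathrm h}$ with these objects as vertices, whose edges $J\colon A\nrightarrow B$ are called horizontal morphisms; and a class of cells. Each cell $\phi$ has a horizontal source, which is a (possibly empty) path $\underline J=(J_1,\dots,J_n)\colon A_0\nrightarrow A_n$ of horizontal morphisms; a horizontal target, which is a path $\underline K\colon C\nrightarrow D$ of length $|\underline K|\le 1$; a vertical source $f\colon A_0\to C$; and a vertical target $g\colon A_n\to D$. We write $\phi\colon\underline J\Rightarrow\underline K$. The empty path at $A$ is written $(A)$ (so $\underline K=(C)$ forces $C=D$), and $\frown$ denotes concatenation of paths. For each $n\ge 1$, each path of cells $\phi_i\colon\underline J_i\Rightarrow\underline K_i$ ($1\le i\le n$) with vertical source $f_{i-1}$ and vertical target $f_i$,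 and each cell $\psi\colon\underline K_1\frown\dots\frown\underline K_n\Rightarrow\underline L$ with vertical source $h$ and target $k$, there is a vertical composite $\psi\circ(\phi_1,\dots,\phi_n)\colon\underline J_1\frown\dots\frown\underline J_n\Rightarrow\underline L$ with vertical source $h\circ f_0$ and target $k\circ f_n$. There are horizontal identity cells $\mathrm{id}_J\colon J\Rightarrow J$ (with identities as vertical source and target) and vertical identity cells $\mathrm{id}_f\colon (A)\Rightarrow(C)$ for $f\colon A\to C$ (with vertical source and target $f$), with $\mathrm{id}_h\circ(\mathrm{id}_f)=\mathrm{id}_{h\circ f}$; write $\mathrm{id}_A:=\mathrm{id}_{\mathrm{id}_A}$. Axioms, whenever they make sense (for associativity: whenever both sides make sense): $\chi\circ(\psi_1\circ(\phi_{11},\dots,\phi_{1m_1}),\dots,\psi_n\circ(\phi_{n1},\dots,\phi_{nm_n}))=(\chi\circ(\psi_1,\dots,\psi_n))\circ(\phi_{11},\dots,\phi_{nm_n})$; $\mathrm{id}_C\circ(\phi)=\phi$; $\mathrm{id}_K\circ(\phi)=\phi$; $\phi\circ(\mathrm{id}_A)=\phi$; $\phi\circ(\mathrm{id}_{J_1},\dots,\mathrm{id}_{J_n})=\phi$; and $\psi\circ(\phi_1,\dots,\phi_i,\mathrm{id}_{f_i},\phi_{i+1},\dots,\phi_n)=\psi\circ(\phi_1,\dots,\phi_n)$ for $0\le i\le n$. A cell is vertical if both its horizontal source and target are empty. Whiskering: $h\circ\phi:=\mathrm{id}_h\circ(\phi)$ and $\psi\circ f:=\psi\circ(\mathrm{id}_f)$.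 Horizontal composition of cells: if $\phi\colon\underline J\Rightarrow\underline K$ and $\psi\colon\underline H\Rightarrow\underline L$ are such that the vertical target of $\phi$ is the vertical source of $\psi$ and $|\underline K|+|\underline L|\le1$, then $\phi\odot\psi:=\mathrm{id}_{\underline K\frown\underline L}\circ(\phi,\psi)\colon\underline J\frown\underline H\Rightarrow\underline K\frown\underline L$, where $\mathrm{id}_{\underline K\frown\underline L}$ is the identity cell of the single horizontal morphism in $\underline K\frown\underline L$, or $\mathrm{id}_C$ if $\underline K\frown\underline L=(C)$. $V(\mathcal K)$ is the 2-category of objects, vertical morphisms and vertical cells, where a vertical cell with vertical source $f$ and target $g$ is a 2-cell $f\Rightarrow g$; composition of 2-cells between parallel morphisms is given by $\odot$ (in diagrammatic order) and composition along objects by $\circ$. **Cartesian cells and companions.** A cell $\psi\colon\underline J\Rightarrow\underline K$ with $|\underline J|\le1$, $\underline J\colon A\nrightarrow B$, vertical source $f\colon A\to C$ and target $g\colon B\to D$, is cartesian if every cell $\chi\colon\underline H\Rightarrow\underline K$, with $\underline H\colon X_0\nrightarrow X_n$ and with vertical source $f\circ h$ and target $g\circ k$ (for any $h\colon X_0\to A$, $k\colon X_n\to B$), factors as $\chi=\psi\circ\phi$ for a unique $\phi\colon\underline H\Rightarrow\underline J$ with vertical source $h$ and target $k$. The companion of $j\colon A\to B$ is a horizontal morphism $j_*\colon A\nrightarrow B$ with a cartesian cell $\varepsilon_j\colon j_*\Rightarrow(B)$ with vertical source $j$ and target $\mathrm{id}_B$. The corresponding weakly cocartesian cell $\eta_j\colon(A)\Rightarrow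 j_*$, with vertical source $\mathrm{id}_A$ and target $j$, is the unique cell with $\varepsilon_j\circ\eta_j=\mathrm{id}_j$; weakly cocartesian means that every cell $\chi\colon(A)\Rightarrow\underline K$ with vertical source $p$ and target $q\circ j$ factors as $\chi=\chi'\circ\eta_j$ for a unique $\chi'\colon j_*\Rightarrow\underline K$ with vertical source $p$ and target $q$. **Absolute left lifting.** $\psi\colon f\Rightarrow g\circ j$ defines $j$ as the absolute left lifting of $f$ along $g$ in $V(\mathcal K)$ if for all $h\colon X\to A$, $k\colon X\to B$ and every 2-cell $\chi\colon f\circ h\Rightarrow g\circ k$ there is a unique 2-cell $\xi\colon j\circ h\Rightarrow k$ with $\chi=(\psi\circ h)\odot(g\circ\xi)$. *)

theory Defs
  imports Main
begin

section \<open>Augmented virtual double categories\<close>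

text \<open>A path of horizontal morphisms is a start object together with a list of edges, so
  that \<open>(A, [])\<close> is the empty path at \<open>A\<close>.\<close>

type_synonym ('o, 'h) hpath = "'o \<times> 'h list"

text \<open>\<open>h \<cdot> f\<close> is \<open>h\<close> after \<open>f\<close>; \<open>\<psi> \<star> [\<phi>\<^sub>1, \<dots>, \<phi>\<^sub>n]\<close> is the vertical composite
  \<open>\<psi> \<circ> (\<phi>\<^sub>1, \<dots>, \<phi>\<^sub>n)\<close>.  Both operations are total functions that are only meaningful on
  composable arguments.\<close>

record ('o, 'v, 'h, 'c) avdc =
  Obj :: "'o set"
  Ver :: "'v set"
  vdom :: "'v \<Rightarrow> 'o"
  vcod :: "'v \<Rightarrow> 'o"
  vid :: "'o \<Rightarrow> 'v"
  vcomp :: "'v \<Rightarrow> 'v \<Rightarrow> 'v" (infixr "\<cdot>\<index>" 75)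
  Hor :: "'h set"
  hdom :: "'h \<Rightarrow> 'o"
  hcod :: "'h \<Rightarrow> 'o"
  Cell :: "'c set"
  hsrc :: "'c \<Rightarrow> ('o, 'h) hpath"
  htgt :: "'c \<Rightarrow> ('o, 'h) hpath"
  vsrc :: "'c \<Rightarrow> 'v"
  vtgt :: "'c \<Rightarrow> 'v"
  ccomp :: "'c \<Rightarrow> 'c list \<Rightarrow> 'c" (infixr "\<star>\<index>" 72)
  hidcell :: "'h \<Rightarrow> 'c"
  vidcell :: "'v \<Rightarrow> 'c"

definition vhom :: "('o, 'v, 'h, 'c) avdc \<Rightarrow> 'o \<Rightarrow> 'o \<Rightarrow> 'v set" where
  "vhom K A B = {f \<in> Ver K. vdom K f = A \<and> vcod K f = B}"

fun is_chain :: "('o, 'v, 'h, 'c) avdc \<Rightarrow> 'o \<Rightarrow> 'h list \<Rightarrow> bool" where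
  "is_chain K A [] \<longleftrightarrow> A \<in> Obj K"
| "is_chain K A (J # Js) \<longleftrightarrow> J \<in> Hor K \<and> hdom K J = A \<and> is_chain K (hcod K J) Js"

definition is_hpath :: "('o, 'v, 'h, 'c) avdc \<Rightarrow> ('o, 'h) hpath \<Rightarrow> bool" where
  "is_hpath K P \<longleftrightarrow> is_chain K (fst P) (snd P)"

definition pstart :: "('o, 'h) hpath \<Rightarrow> 'o" where
  "pstart P = fst P"

definition pend :: "('o, 'v, 'h, 'c) avdc \<Rightarrow> ('o, 'h) hpath \<Rightarrow> 'o" where
  "pend K P = (if snd P = [] then fst P else hcod K (last (snd P)))"

definition plength :: "('o, 'h) hpath \<Rightarrow> nat" where
  "plength P = length (snd P)"

text \<open>The concatenation of a nonempty list of consecutive paths.\<close>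

definition pconcat :: "('o, 'h) hpath list \<Rightarrow> ('o, 'h) hpath" where
  "pconcat Ps = (fst (hd Ps), concat (map snd Ps))"

definition cells ::
  "('o, 'v, 'h, 'c) avdc \<Rightarrow> ('o, 'h) hpath \<Rightarrow> ('o, 'h) hpath \<Rightarrow> 'v \<Rightarrow> 'v \<Rightarrow> 'c set" where
  "cells K P Q f g =
     {\<phi> \<in> Cell K. hsrc K \<phi> = P \<and> htgt K \<phi> = Q \<and> vsrc K \<phi> = f \<and> vtgt K \<phi> = g}"

definition composable :: "('o, 'v, 'h, 'c) avdc \<Rightarrow> 'c \<Rightarrow> 'c list \<Rightarrow> bool" where
  "composable K \<psi> \<phi>s \<longleftrightarrow>
     \<psi> \<in> Cell K \<and> \<phi>s \<noteq> [] \<and> set \<phi>s \<subseteq> Cell K \<and>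
     (\<forall>i. Suc i < length \<phi>s \<longrightarrow> vtgt K (\<phi>s ! i) = vsrc K (\<phi>s ! Suc i)) \<and>
     hsrc K \<psi> = pconcat (map (htgt K) \<phi>s)"

text \<open>In \<open>ccomp_assoc\<close> all composability hypotheses are needed: composability of \<open>\<chi>\<close> with
  the composites \<open>\<psi>\<^sub>i \<star> \<phi>\<^sub>i\<close> does not imply that the \<open>\<psi>\<^sub>i\<close> themselves form a path.
  In \<open>ccomp_insert_id\<close> the hypotheses force \<open>f\<close> to be the vertical morphism shared by the
  cells adjacent to it.\<close>

locale augmented_virtual_double_category =
  fixes K :: "('o, 'v, 'h, 'c) avdc" (structure)
  assumes vdom_Obj: "f \<in> Ver K \<Longrightarrow> vdom K f \<in> Obj K"
    and vcod_Obj: "f \<in> Ver K \<Longrightarrow> vcod K f \<in> Obj K"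
    and vid_vhom: "A \<in> Obj K \<Longrightarrow> vid K A \<in> vhom K A A"
    and vcomp_vhom: "f \<in> vhom K A B \<Longrightarrow> h \<in> vhom K B C \<Longrightarrow> h \<cdot> f \<in> vhom K A C"
    and vcomp_assoc: "f \<in> vhom K A B \<Longrightarrow> g \<in> vhom K B C \<Longrightarrow> h \<in> vhom K C D \<Longrightarrow>
      (h \<cdot> g) \<cdot> f = h \<cdot> (g \<cdot> f)"
    and vcomp_vid: "f \<in> vhom K A B \<Longrightarrow> f \<cdot> vid K A = f"
    and vid_vcomp: "f \<in> vhom K A B \<Longrightarrow> vid K B \<cdot> f = f"
    and hdom_Obj: "J \<in> Hor K \<Longrightarrow> hdom K J \<in> Obj K"
    and hcod_Obj: "J \<in> Hor K \<Longrightarrow> hcod K J \<in> Obj K"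
    and hsrc_hpath: "\<phi> \<in> Cell K \<Longrightarrow> is_hpath K (hsrc K \<phi>)"
    and htgt_hpath: "\<phi> \<in> Cell K \<Longrightarrow> is_hpath K (htgt K \<phi>)"
    and htgt_length: "\<phi> \<in> Cell K \<Longrightarrow> plength (htgt K \<phi>) \<le> 1"
    and vsrc_vhom: "\<phi> \<in> Cell K \<Longrightarrow> vsrc K \<phi> \<in> vhom K (pstart (hsrc K \<phi>)) (pstart (htgt K \<phi>))"
    and vtgt_vhom: "\<phi> \<in> Cell K \<Longrightarrow> vtgt K \<phi> \<in> vhom K (pend K (hsrc K \<phi>)) (pend K (htgt K \<phi>))"
    and ccomp_cells: "composable K \<psi> \<phi>s \<Longrightarrow>
      \<psi> \<star> \<phi>s \<in> cells K (pconcat (map (hsrc K) \<phi>s)) (htgt K \<psi>)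
                 (vsrc K \<psi> \<cdot> vsrc K (hd \<phi>s)) (vtgt K \<psi> \<cdot> vtgt K (last \<phi>s))"
    and hidcell_cells: "J \<in> Hor K \<Longrightarrow>
      hidcell K J \<in> cells K (hdom K J, [J]) (hdom K J, [J]) (vid K (hdom K J)) (vid K (hcod K J))"
    and vidcell_cells: "f \<in> vhom K A C \<Longrightarrow> vidcell K f \<in> cells K (A, []) (C, []) f f"
    and vidcell_vcomp: "f \<in> vhom K A B \<Longrightarrow> h \<in> vhom K B C \<Longrightarrow>
      vidcell K h \<star> [vidcell K f] = vidcell K (h \<cdot> f)"
    and ccomp_assoc: "length \<phi>ss = length \<psi>s \<Longrightarrow>
      (\<And>i. i < length \<psi>s \<Longrightarrow> composable K (\<psi>s ! i) (\<phi>ss ! i)) \<Longrightarrow>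
      composable K \<chi> (map2 (ccomp K) \<psi>s \<phi>ss) \<Longrightarrow>
      composable K \<chi> \<psi>s \<Longrightarrow> composable K (\<chi> \<star> \<psi>s) (concat \<phi>ss) \<Longrightarrow>
      \<chi> \<star> map2 (ccomp K) \<psi>s \<phi>ss = (\<chi> \<star> \<psi>s) \<star> concat \<phi>ss"
    and vid_ccomp: "\<phi> \<in> Cell K \<Longrightarrow> htgt K \<phi> = (C, []) \<Longrightarrow> vidcell K (vid K C) \<star> [\<phi>] = \<phi>"
    and hid_ccomp: "\<phi> \<in> Cell K \<Longrightarrow> htgt K \<phi> = (C, [J]) \<Longrightarrow> hidcell K J \<star> [\<phi>] = \<phi>"
    and ccomp_vid: "\<phi> \<in> Cell K \<Longrightarrow> hsrc K \<phi> = (A, []) \<Longrightarrow> \<phi> \<star> [vidcell K (vid K A)] = \<phi>"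
    and ccomp_hids: "\<phi> \<in> Cell K \<Longrightarrow> hsrc K \<phi> = (A, Js) \<Longrightarrow> Js \<noteq> [] \<Longrightarrow>
      \<phi> \<star> map (hidcell K) Js = \<phi>"
    and ccomp_insert_id: "f \<in> Ver K \<Longrightarrow> composable K \<psi> (\<phi>s @ \<phi>s') \<Longrightarrow>
      composable K \<psi> (\<phi>s @ vidcell K f # \<phi>s') \<Longrightarrow>
      \<psi> \<star> (\<phi>s @ vidcell K f # \<phi>s') = \<psi> \<star> (\<phi>s @ \<phi>s')"

definition whisker_left :: "('o, 'v, 'h, 'c) avdc \<Rightarrow> 'v \<Rightarrow> 'c \<Rightarrow> 'c" where
  "whisker_left K h \<phi> = vidcell K h \<star>\<^bsub>K\<^esub> [\<phi>]"

definition whisker_right :: "('o, 'v, 'h, 'c) avdc \<Rightarrow> 'c \<Rightarrow> 'v \<Rightarrow> 'c" where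
  "whisker_right K \<psi> f = \<psi> \<star>\<^bsub>K\<^esub> [vidcell K f]"

text \<open>The identity cell of a path of length at most one.\<close>

definition pathid :: "('o, 'v, 'h, 'c) avdc \<Rightarrow> ('o, 'h) hpath \<Rightarrow> 'c" where
  "pathid K P = (if snd P = [] then vidcell K (vid K (fst P)) else hidcell K (hd (snd P)))"

text \<open>Meaningful if \<open>vtgt K \<phi> = vsrc K \<psi>\<close> and the horizontal targets have total length
  at most one.\<close>

definition hcomp :: "('o, 'v, 'h, 'c) avdc \<Rightarrow> 'c \<Rightarrow> 'c \<Rightarrow> 'c" (infixl "\<odot>\<index>" 70) where
  "\<phi> \<odot>\<^bsub>K\<^esub> \<psi> = pathid K (pconcat [htgt K \<phi>, htgt K \<psi>]) \<star>\<^bsub>K\<^esub> [\<phi>, \<psi>]"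

section \<open>Cartesian cells and companions\<close>

definition cartesian :: "('o, 'v, 'h, 'c) avdc \<Rightarrow> 'c \<Rightarrow> bool" where
  "cartesian K \<psi> \<longleftrightarrow>
     \<psi> \<in> Cell K \<and> plength (hsrc K \<psi>) \<le> 1 \<and>
     (\<forall>H h k \<chi>. is_hpath K H \<longrightarrow>
        h \<in> vhom K (pstart H) (pstart (hsrc K \<psi>)) \<longrightarrow>
        k \<in> vhom K (pend K H) (pend K (hsrc K \<psi>)) \<longrightarrow>
        \<chi> \<in> cells K H (htgt K \<psi>) (vsrc K \<psi> \<cdot>\<^bsub>K\<^esub> h) (vtgt K \<psi> \<cdot>\<^bsub>K\<^esub> k) \<longrightarrow>
        (\<exists>!\<phi>. \<phi> \<in> cells K H (hsrc K \<psi>) h k \<and> \<chi> = \<psi> \<star>\<^bsub>K\<^esub> [\<phi>]))"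

text \<open>\<open>J\<close> is the companion of \<open>j\<close>, with defining cartesian cell \<open>\<epsilon>\<close>.\<close>

definition is_companion :: "('o, 'v, 'h, 'c) avdc \<Rightarrow> 'v \<Rightarrow> 'h \<Rightarrow> 'c \<Rightarrow> bool" where
  "is_companion K j J \<epsilon> \<longleftrightarrow>
     j \<in> Ver K \<and>
     \<epsilon> \<in> cells K (vdom K j, [J]) (vcod K j, []) j (vid K (vcod K j)) \<and>
     cartesian K \<epsilon>"

text \<open>\<open>\<eta>\<close> is the cell corresponding to \<open>\<epsilon>\<close>.  Its existence and uniqueness, and its being
  weakly cocartesian, are consequences; see \<open>companion_cell_ex1\<close> and
  \<open>companion_cell_weakly_cocartesian\<close> below.\<close>

definition is_companion_cell ::
  "('o, 'v, 'h, 'c) avdc \<Rightarrow> 'v \<Rightarrow> 'h \<Rightarrow> 'c \<Rightarrow> 'c \<Rightarrow> bool" where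
  "is_companion_cell K j J \<epsilon> \<eta> \<longleftrightarrow>
     \<eta> \<in> cells K (vdom K j, []) (vdom K j, [J]) (vid K (vdom K j)) j \<and>
     \<epsilon> \<star>\<^bsub>K\<^esub> [\<eta>] = vidcell K j"

definition weakly_cocartesian :: "('o, 'v, 'h, 'c) avdc \<Rightarrow> 'v \<Rightarrow> 'h \<Rightarrow> 'c \<Rightarrow> bool" where
  "weakly_cocartesian K j J \<eta> \<longleftrightarrow>
     \<eta> \<in> cells K (vdom K j, []) (vdom K j, [J]) (vid K (vdom K j)) j \<and>
     (\<forall>P p q \<chi>. is_hpath K P \<longrightarrow> plength P \<le> 1 \<longrightarrow>
        p \<in> vhom K (vdom K j) (pstart P) \<longrightarrow> q \<in> vhom K (vcod K j) (pend K P) \<longrightarrow>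
        \<chi> \<in> cells K (vdom K j, []) P p (q \<cdot>\<^bsub>K\<^esub> j) \<longrightarrow>
        (\<exists>!\<chi>'. \<chi>' \<in> cells K (vdom K j, [J]) P p q \<and> \<chi> = \<chi>' \<star>\<^bsub>K\<^esub> [\<eta>]))"

context augmented_virtual_double_category
begin

lemma vhomD: "f \<in> vhom K A B \<Longrightarrow> f \<in> Ver K \<and> vdom K f = A \<and> vcod K f = B"
  by (simp add: vhom_def)

lemma cells_vhom:
  assumes "\<phi> \<in> cells K P Q f g"
  shows "f \<in> vhom K (fst P) (fst Q)" "g \<in> vhom K (pend K P) (pend K Q)"
  using assms vsrc_vhom[of \<phi>] vtgt_vhom[of \<phi>] by (auto simp: cells_def pstart_def)

lemma cells_Cell: "\<phi> \<in> cells K P Q f g \<Longrightarrow> \<phi> \<in> Cell K"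
  by (simp add: cells_def)

lemma pconcat_single [simp]: "pconcat [P] = P"
  by (simp add: pconcat_def)

lemma composable1:
  assumes "\<phi> \<in> cells K P Q f g" "\<psi> \<in> cells K Q R h k"
  shows "composable K \<psi> [\<phi>]"
  using assms by (simp add: composable_def cells_def)

lemma composable2:
  assumes "\<phi>1 \<in> cells K P1 Q1 f0 f1" "\<phi>2 \<in> cells K P2 Q2 f1 f2"
    and "\<psi> \<in> cells K Q R h k" "Q = pconcat [Q1, Q2]"
  shows "composable K \<psi> [\<phi>1, \<phi>2]"
  using assms by (auto simp: composable_def cells_def less_Suc_eq)

lemma ccomp1_cells:
  assumes "\<phi> \<in> cells K P Q f g" "\<psi> \<in> cells K Q R h k"
  shows "\<psi> \<star> [\<phi>] \<in> cells K P R (h \<cdot> f) (k \<cdot> g)"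
  using ccomp_cells[OF composable1[OF assms]] assms by (simp add: cells_def)

lemma ccomp2_cells:
  assumes "\<phi>1 \<in> cells K P1 Q1 f0 f1" "\<phi>2 \<in> cells K P2 Q2 f1 f2"
    and "\<psi> \<in> cells K Q R h k" "Q = pconcat [Q1, Q2]"
  shows "\<psi> \<star> [\<phi>1, \<phi>2] \<in> cells K (pconcat [P1, P2]) R (h \<cdot> f0) (k \<cdot> f2)"
  using ccomp_cells[OF composable2[OF assms]] assms by (simp add: cells_def)

lemma ccomp_assoc11:
  assumes "\<phi> \<in> cells K P Q f g" "\<psi> \<in> cells K Q R h k" "\<chi> \<in> cells K R S m n"
  shows "\<chi> \<star> [\<psi> \<star> [\<phi>]] = (\<chi> \<star> [\<psi>]) \<star> [\<phi>]"
  using ccomp_assoc[of "[[\<phi>]]" "[\<psi>]" \<chi>] composable1[OF assms(1,2)]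
    composable1[OF assms(2,3)] composable1[OF ccomp1_cells[OF assms(1,2)] assms(3)]
    composable1[OF assms(1) ccomp1_cells[OF assms(2,3)]]
  by simp

lemma ccomp_assoc12:
  assumes "\<phi>1 \<in> cells K P1 Q1 f0 f1" "\<phi>2 \<in> cells K P2 Q2 f1 f2"
    and "\<psi> \<in> cells K Q R h k" "Q = pconcat [Q1, Q2]" "\<chi> \<in> cells K R S m n"
  shows "\<chi> \<star> [\<psi> \<star> [\<phi>1, \<phi>2]] = (\<chi> \<star> [\<psi>]) \<star> [\<phi>1, \<phi>2]"
  using ccomp_assoc[of "[[\<phi>1, \<phi>2]]" "[\<psi>]" \<chi>] composable2[OF assms(1-4)]
    composable1[OF assms(3,5)] composable1[OF ccomp2_cells[OF assms(1-4)] assms(5)]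
    composable2[OF assms(1,2) ccomp1_cells[OF assms(3,5)] assms(4)]
  by simp

lemma ccomp_assoc22:
  assumes "\<phi>1 \<in> cells K P1 Q1 f0 f1" "\<phi>2 \<in> cells K P2 Q2 f1 f2"
    and "\<psi>1 \<in> cells K Q1 R1 h0 h1" "\<psi>2 \<in> cells K Q2 R2 h1 h2"
    and "\<chi> \<in> cells K R S m n" "R = pconcat [R1, R2]"
  shows "\<chi> \<star> [\<psi>1 \<star> [\<phi>1], \<psi>2 \<star> [\<phi>2]] = (\<chi> \<star> [\<psi>1, \<psi>2]) \<star> [\<phi>1, \<phi>2]"
proof -
  have "composable K ([\<psi>1, \<psi>2] ! i) ([[\<phi>1], [\<phi>2]] ! i)" if "i < 2" for i
    using that composable1[OF assms(1,3)] composable1[OF assms(2,4)]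
    by (auto simp: less_2_cases_iff)
  then show ?thesis
    using ccomp_assoc[of "[[\<phi>1], [\<phi>2]]" "[\<psi>1, \<psi>2]" \<chi>]
      composable2[OF assms(3-6)]
      composable2[OF ccomp1_cells[OF assms(1,3)] ccomp1_cells[OF assms(2,4)] assms(5,6)]
      composable2[OF assms(1,2) ccomp2_cells[OF assms(3-6)] refl]
    by simp
qed

lemma insert_id_right:
  assumes "\<phi> \<in> cells K P Q f g" "\<psi> \<in> cells K Q R h k" "g \<in> vhom K B D"
  shows "\<psi> \<star> [\<phi>, vidcell K g] = \<psi> \<star> [\<phi>]"
  using ccomp_insert_id[of g \<psi> "[\<phi>]" "[]"] composable1[OF assms(1,2)]
    composable2[OF assms(1) vidcell_cells[OF assms(3)] assms(2)] vhomD[OF assms(3)]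
  by (simp add: pconcat_def)

lemma insert_id_left:
  assumes "\<phi> \<in> cells K P Q f g" "\<psi> \<in> cells K Q R h k"
  shows "\<psi> \<star> [vidcell K f, \<phi>] = \<psi> \<star> [\<phi>]"
  using ccomp_insert_id[of f \<psi> "[]" "[\<phi>]"] composable1[OF assms(1,2)]
    composable2[OF vidcell_cells[OF cells_vhom(1)[OF assms(1)]] assms(1,2)]
    vhomD[OF cells_vhom(1)[OF assms(1)]]
  by (simp add: pconcat_def)

lemma is_chain_start: "is_chain K A Js \<Longrightarrow> A \<in> Obj K"
  using hdom_Obj by (cases Js) auto

lemma pathid_cells:
  assumes "is_hpath K P" "plength P \<le> 1"
  shows "pathid K P \<in> cells K P P (vid K (fst P)) (vid K (pend K P))"
proof (cases "snd P")
  case Nil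
  then obtain A where "A \<in> Obj K" "P = (A, [])"
    using assms(1) by (cases P) (auto simp: is_hpath_def)
  with vidcell_cells[OF vid_vhom] show ?thesis
    by (simp add: pathid_def pend_def)
next
  case (Cons J Js)
  then have "P = (hdom K J, [J])" "J \<in> Hor K"
    using assms by (auto simp: is_hpath_def prod_eq_iff plength_def)
  with hidcell_cells show ?thesis
    by (simp add: pathid_def pend_def)
qed

lemma pathid_ccomp:
  assumes "\<phi> \<in> cells K P Q f g"
  shows "pathid K Q \<star> [\<phi>] = \<phi>"
proof (cases "snd Q")
  case Nil
  with assms show ?thesis
    using vid_ccomp[of \<phi> "fst Q"] by (simp add: pathid_def cells_def prod_eq_iff)
next
  case (Cons J Js)
  with assms htgt_length[of \<phi>] have "htgt K \<phi> = (fst Q, [J])"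
    by (auto simp: cells_def prod_eq_iff plength_def)
  with Cons assms show ?thesis
    using hid_ccomp[of \<phi> "fst Q" J] by (simp add: pathid_def cells_def)
qed

lemma companion_cell_ex1:
  assumes "is_companion K j J \<epsilon>"
  shows "\<exists>!\<eta>. is_companion_cell K j J \<epsilon> \<eta>"
proof -
  let ?A = "vdom K j" and ?B = "vcod K j"
  have j: "j \<in> vhom K ?A ?B"
    and eps: "\<epsilon> \<in> cells K (?A, [J]) (?B, []) j (vid K ?B)" and cart: "cartesian K \<epsilon>"
    using assms by (auto simp: is_companion_def vhom_def)
  have A: "?A \<in> Obj K" using j vdom_Obj by (auto simp: vhom_def)
  have "hcod K J = ?B"
    using cells_vhom(2)[OF eps] vid_vhom[OF vcod_Obj[of j]] j by (auto simp: vhom_def pend_def)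
  then have "\<exists>!\<eta>. \<eta> \<in> cells K (?A, []) (?A, [J]) (vid K ?A) j \<and> vidcell K j = \<epsilon> \<star> [\<eta>]"
    using cart eps vidcell_cells[OF j] vid_vhom[OF A] j A vcomp_vid[OF j] vid_vcomp[OF j]
    unfolding cartesian_def
    by (elim conjE allE[where x = "(?A, [])"] allE[where x = "vid K ?A"] allE[where x = j]
          allE[where x = "vidcell K j"])
       (simp add: is_hpath_def pstart_def pend_def cells_def)
  then show ?thesis
    unfolding is_companion_cell_def by (metis (no_types, lifting))
qed

lemma companion_facts:
  assumes "is_companion K j J \<epsilon>"
  shows "j \<in> vhom K (vdom K j) (vcod K j)" "vdom K j \<in> Obj K" "vcod K j \<in> Obj K"
    "J \<in> Hor K" "hdom K J = vdom K j" "hcod K J = vcod K j"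
    "\<epsilon> \<in> cells K (vdom K j, [J]) (vcod K j, []) j (vid K (vcod K j))" "cartesian K \<epsilon>"
proof -
  show j: "j \<in> vhom K (vdom K j) (vcod K j)"
    and eps: "\<epsilon> \<in> cells K (vdom K j, [J]) (vcod K j, []) j (vid K (vcod K j))"
    and "cartesian K \<epsilon>"
    using assms by (auto simp: is_companion_def vhom_def)
  show "vdom K j \<in> Obj K" "vcod K j \<in> Obj K" using j vdom_Obj vcod_Obj by (auto simp: vhom_def)
  show "J \<in> Hor K" "hdom K J = vdom K j"
    using hsrc_hpath[of \<epsilon>] eps by (auto simp: cells_def is_hpath_def)
  show "hcod K J = vcod K j"
    using cells_vhom(2)[OF eps] vid_vhom[OF vcod_Obj[of j]] j by (auto simp: vhom_def pend_def)
qed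

lemma companion_horizontal_identity:
  assumes comp: "is_companion K j J \<epsilon>" and eta: "is_companion_cell K j J \<epsilon> \<eta>"
  shows "hidcell K J \<star> [\<eta>, \<epsilon>] = hidcell K J"
proof -
  note c = companion_facts[OF comp]
  let ?A = "vdom K j" and ?B = "vcod K j"
  have eta: "\<eta> \<in> cells K (?A, []) (?A, [J]) (vid K ?A) j" and ee: "\<epsilon> \<star> [\<eta>] = vidcell K j"
    using eta by (auto simp: is_companion_cell_def)
  have hid: "hidcell K J \<in> cells K (?A, [J]) (?A, [J]) (vid K ?A) (vid K ?B)"
    using hidcell_cells[OF c(4)] c by simp
  have idB: "vidcell K (vid K ?B) \<in> cells K (?B, []) (?B, []) (vid K ?B) (vid K ?B)"
    by (intro vidcell_cells vid_vhom c)
  have vid: "vid K ?A \<cdot> vid K ?A = vid K ?A" "vid K ?B \<cdot> vid K ?B = vid K ?B"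
    using vcomp_vid[OF vid_vhom] c by auto
  have jid: "j \<cdot> vid K ?A = j" by (rule vcomp_vid[OF c(1)])
  have pc: "(?A, [J]) = pconcat [(?A, [J]), (?B, [])]" "(?B, []) = pconcat [(?B, []), (?B, [])]"
    by (simp_all add: pconcat_def)
  have L: "hidcell K J \<star> [\<eta>, \<epsilon>] \<in> cells K (?A, [J]) (?A, [J]) (vid K ?A) (vid K ?B)"
    using ccomp2_cells[OF eta c(7) hid pc(1)] vid by (simp add: pconcat_def)
  have R: "\<epsilon> \<star> [hidcell K J] = \<epsilon>"
    using ccomp_hids[of \<epsilon> ?A "[J]"] c(7) by (simp add: cells_def)
  have "\<epsilon> \<star> [hidcell K J \<star> [\<eta>, \<epsilon>]] = \<epsilon> \<star> [\<eta>, \<epsilon>]"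
    using ccomp_assoc12[OF eta c(7) hid pc(1) c(7)] R by simp
  also have "\<dots> = (vidcell K (vid K ?B) \<star> [\<epsilon>, vidcell K (vid K ?B)]) \<star> [\<eta>, \<epsilon>]"
    using insert_id_right[OF c(7) idB vid_vhom[OF c(3)]] pathid_ccomp[OF c(7)]
    by (simp add: pathid_def)
  also have "\<dots> = vidcell K (vid K ?B) \<star> [\<epsilon> \<star> [\<eta>], vidcell K (vid K ?B) \<star> [\<epsilon>]]"
    using ccomp_assoc22[OF eta c(7) c(7) idB idB pc(2)] by simp
  also have "\<dots> = vidcell K (vid K ?B) \<star> [vidcell K j, \<epsilon>]"
    using pathid_ccomp[OF c(7)] ee by (simp add: pathid_def)
  also have "\<dots> = \<epsilon>"
    using insert_id_left[OF c(7) idB] pathid_ccomp[OF c(7)] by (simp add: pathid_def)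
  finally have E: "\<epsilon> \<star> [hidcell K J \<star> [\<eta>, \<epsilon>]] = \<epsilon>" .
  have "\<exists>!\<phi>. \<phi> \<in> cells K (?A, [J]) (?A, [J]) (vid K ?A) (vid K ?B) \<and> \<epsilon> = \<epsilon> \<star> [\<phi>]"
    using c(8) c(7) vid_vhom[OF c(2)] vid_vhom[OF c(3)] c jid vid
    unfolding cartesian_def
    by (elim conjE allE[where x = "(?A, [J])"] allE[where x = "vid K ?A"]
          allE[where x = "vid K ?B"] allE[where x = \<epsilon>])
       (simp add: is_hpath_def pstart_def pend_def cells_def)
  with L hid E R show ?thesis by (metis (no_types, lifting))
qed

lemma companion_decomposition:
  assumes comp: "is_companion K j J \<epsilon>" and eta: "is_companion_cell K j J \<epsilon> \<eta>"
    and x: "\<chi> \<in> cells K (vdom K j, [J]) P p q"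
  shows "\<chi> = pathid K P \<star> [\<chi> \<star> [\<eta>], vidcell K q \<star> [\<epsilon>]]"
proof -
  note c = companion_facts[OF comp]
  let ?A = "vdom K j" and ?B = "vcod K j"
  have eta': "\<eta> \<in> cells K (?A, []) (?A, [J]) (vid K ?A) j"
    using eta by (auto simp: is_companion_cell_def)
  have hid: "hidcell K J \<in> cells K (?A, [J]) (?A, [J]) (vid K ?A) (vid K ?B)"
    using hidcell_cells[OF c(4)] c by simp
  have P: "is_hpath K P" "plength P \<le> 1"
    using x htgt_hpath[of \<chi>] htgt_length[of \<chi>] by (auto simp: cells_def)
  have q: "q \<in> vhom K ?B (pend K P)"
    using cells_vhom(2)[OF x] c by (simp add: pend_def)
  have pc: "(?A, [J]) = pconcat [(?A, [J]), (?B, [])]" "P = pconcat [P, (pend K P, [])]"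
    by (simp_all add: pconcat_def)
  have R: "\<chi> \<star> [hidcell K J] = \<chi>"
    using ccomp_hids[of \<chi> ?A "[J]"] x by (simp add: cells_def)
  have "\<chi> = (\<chi> \<star> [hidcell K J]) \<star> [\<eta>, \<epsilon>]"
    using ccomp_assoc12[OF eta' c(7) hid pc(1) x] companion_horizontal_identity[OF comp eta] R
    by simp
  also have "\<dots> = (pathid K P \<star> [\<chi>, vidcell K q]) \<star> [\<eta>, \<epsilon>]"
    using insert_id_right[OF x pathid_cells[OF P] q] pathid_ccomp[OF x] R by simp
  also have "\<dots> = pathid K P \<star> [\<chi> \<star> [\<eta>], vidcell K q \<star> [\<epsilon>]]"
    using ccomp_assoc22[OF eta' c(7) x vidcell_cells[OF q] pathid_cells[OF P] pc(2)] by simp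
  finally show ?thesis .
qed

lemma companion_cell_weakly_cocartesian:
  assumes comp: "is_companion K j J \<epsilon>" and eta: "is_companion_cell K j J \<epsilon> \<eta>"
  shows "weakly_cocartesian K j J \<eta>"
proof -
  note c = companion_facts[OF comp]
  let ?A = "vdom K j" and ?B = "vcod K j"
  have eta': "\<eta> \<in> cells K (?A, []) (?A, [J]) (vid K ?A) j" and ee: "\<epsilon> \<star> [\<eta>] = vidcell K j"
    using eta by (auto simp: is_companion_cell_def)
  have "\<exists>!\<chi>'. \<chi>' \<in> cells K (?A, [J]) P p q \<and> \<chi> = \<chi>' \<star> [\<eta>]"
    if P: "is_hpath K P" "plength P \<le> 1" and p: "p \<in> vhom K ?A (pstart P)"
      and q: "q \<in> vhom K ?B (pend K P)" and x: "\<chi> \<in> cells K (?A, []) P p (q \<cdot> j)"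
    for P p q \<chi>
  proof (rule ex1I, rule conjI)
    let ?D = "pend K P"
    let ?x = "pathid K P \<star> [\<chi>, vidcell K q \<star> [\<epsilon>]]"
    have qe: "vidcell K q \<star> [\<epsilon>] \<in> cells K (?A, [J]) (?D, []) (q \<cdot> j) q"
      using ccomp1_cells[OF c(7) vidcell_cells[OF q]] vcomp_vid[OF q] by simp
    have pcP: "P = pconcat [P, (?D, [])]" by (simp add: pconcat_def)
    have p': "p \<in> vhom K ?A (fst P)" using p by (simp add: pstart_def)
    show "?x \<in> cells K (?A, [J]) P p q"
      using ccomp2_cells[OF x qe pathid_cells[OF P] pcP] vid_vcomp[OF p'] vid_vcomp[OF q]
      by (simp add: pconcat_def)
    have idA: "vidcell K (vid K ?A) \<in> cells K (?A, []) (?A, []) (vid K ?A) (vid K ?A)"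
      by (intro vidcell_cells vid_vhom c)
    have xx: "?x \<in> cells K (?A, [J]) P p q" by fact
    have "?x \<star> [\<eta>] = ?x \<star> [vidcell K (vid K ?A), \<eta>]"
      using insert_id_left[OF eta' xx] by simp
    also have "\<dots> = pathid K P \<star> [\<chi> \<star> [vidcell K (vid K ?A)], (vidcell K q \<star> [\<epsilon>]) \<star> [\<eta>]]"
      using ccomp_assoc22[OF idA eta' x qe pathid_cells[OF P] pcP] by simp
    also have "\<dots> = pathid K P \<star> [\<chi>, vidcell K (q \<cdot> j)]"
      using ccomp_vid[of \<chi> ?A] x ccomp_assoc11[OF eta' c(7) vidcell_cells[OF q]] ee
        vidcell_vcomp[OF c(1) q]
      by (simp add: cells_def)
    also have "\<dots> = \<chi>"
      using insert_id_right[OF x pathid_cells[OF P] vcomp_vhom[OF c(1) q]] pathid_ccomp[OF x]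
      by simp
    finally show "\<chi> = ?x \<star> [\<eta>]" by simp
    show "\<chi>' = ?x" if "\<chi>' \<in> cells K (?A, [J]) P p q \<and> \<chi> = \<chi>' \<star> [\<eta>]" for \<chi>'
      using companion_decomposition[OF comp eta, of \<chi>' P p q] that by simp
  qed
  then show ?thesis using eta' unfolding weakly_cocartesian_def by blast
qed

end

section \<open>Absolute left liftings of vertical morphisms\<close>

text \<open>The 2-cells \<open>f \<Rightarrow> g\<close> of the 2-category of objects, vertical morphisms and vertical cells,
  whose composition between parallel morphisms is \<open>\<odot>\<close> (in diagrammatic order) and whose
  whiskerings are those above.\<close>

definition vcells :: "('o, 'v, 'h, 'c) avdc \<Rightarrow> 'v \<Rightarrow> 'v \<Rightarrow> 'c set" where
  "vcells K f g = cells K (vdom K f, []) (vcod K f, []) f g"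

definition absolute_left_lifting ::
  "('o, 'v, 'h, 'c) avdc \<Rightarrow> 'v \<Rightarrow> 'v \<Rightarrow> 'v \<Rightarrow> 'c \<Rightarrow> bool" where
  "absolute_left_lifting K f g j \<psi> \<longleftrightarrow>
     \<psi> \<in> vcells K f (g \<cdot>\<^bsub>K\<^esub> j) \<and>
     (\<forall>X h k \<chi>. h \<in> vhom K X (vdom K j) \<longrightarrow> k \<in> vhom K X (vcod K j) \<longrightarrow>
        \<chi> \<in> vcells K (f \<cdot>\<^bsub>K\<^esub> h) (g \<cdot>\<^bsub>K\<^esub> k) \<longrightarrow>
        (\<exists>!\<xi>. \<xi> \<in> vcells K (j \<cdot>\<^bsub>K\<^esub> h) k \<and>
              \<chi> = whisker_right K \<psi> h \<odot>\<^bsub>K\<^esub> whisker_left K g \<xi>))"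

end

theory Submission
  imports Defs
begin

text \<open>Write \<open>\<epsilon>\<close> for the cartesian cell of the companion.  By the companion identities
  \<open>\<psi>' = \<psi> \<odot> (g \<circ> \<epsilon>)\<close>, so that \<open>\<psi>' \<circ> \<phi> = (\<psi> \<circ> h) \<odot> (g \<circ> (\<epsilon> \<circ> \<phi>))\<close> for each
  \<open>\<phi> : (X) \<Rightarrow> j\<^sub>*\<close> with vertical source \<open>h\<close>.  As \<open>\<epsilon>\<close> is cartesian,
  \<open>\<phi> \<mapsto> \<epsilon> \<circ> \<phi>\<close> is a bijection onto the vertical cells \<open>\<xi> : j \<circ> h \<Rightarrow> k\<close>; as \<open>\<psi>'\<close> is
  cartesian, \<open>\<phi> \<mapsto> \<psi>' \<circ> \<phi>\<close> is a bijection onto the vertical cells \<open>f \<circ> h \<Rightarrow> g \<circ> k\<close>.\<close>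

lemma cartesian_ex1:
  assumes "cartesian K \<psi>" "\<psi> \<in> cells K P Q f g" "is_hpath K H"
    and "h \<in> vhom K (pstart H) (pstart P)" "k \<in> vhom K (pend K H) (pend K P)"
    and "\<chi> \<in> cells K H Q (f \<cdot>\<^bsub>K\<^esub> h) (g \<cdot>\<^bsub>K\<^esub> k)"
  shows "\<exists>!\<phi>. \<phi> \<in> cells K H P h k \<and> \<chi> = \<psi> \<star>\<^bsub>K\<^esub> [\<phi>]"
proof -
  have "hsrc K \<psi> = P" "htgt K \<psi> = Q" "vsrc K \<psi> = f" "vtgt K \<psi> = g"
    using assms(2) by (auto simp: cells_def)
  with assms show ?thesis
    unfolding cartesian_def by blast
qed

context augmented_virtual_double_category
begin

lemma hcomp_cells:
  assumes "\<phi> \<in> cells K P Q f g" "\<psi> \<in> cells K P' Q' h k"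
  shows "\<phi> \<odot> \<psi> = pathid K (pconcat [Q, Q']) \<star> [\<phi>, \<psi>]"
  using assms by (simp add: hcomp_def cells_def)

text \<open>\<open>companion_decomposition\<close> splits \<open>\<chi>\<close> into two cells side
  by side, so associativity lets each be composed separately. Taking \<open>\<psi>'\<close> for
  \<open>\<chi>\<close> turns factorisations through \<open>\<psi>'\<close> into the equation that
  defines the lifting.\<close>

lemma ccomp_companion_decomposition:
  assumes comp: "is_companion K j J \<epsilon>" and eta: "is_companion_cell K j J \<epsilon> \<eta>"
    and x: "\<chi> \<in> cells K (vdom K j, [J]) P p q"
    and phi: "\<phi> \<in> cells K H (vdom K j, [J]) h k"
  shows "\<chi> \<star> [\<phi>] =
    whisker_right K (\<chi> \<star> [\<eta>]) h \<odot> whisker_left K q (\<epsilon> \<star> [\<phi>])"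
proof -
  note c = companion_facts[OF comp]
  have eta': "\<eta> \<in> cells K (vdom K j, []) (vdom K j, [J]) (vid K (vdom K j)) j"
    using eta by (simp add: is_companion_cell_def)
  have P: "is_hpath K P" "plength P \<le> 1"
    using x htgt_hpath[of \<chi>] htgt_length[of \<chi>] by (auto simp: cells_def)
  have pcP: "P = pconcat [P, (pend K P, [])]"
    by (simp add: pconcat_def)
  have h: "vidcell K h \<in> cells K (fst H, []) (vdom K j, []) h h"
    using vidcell_cells[OF cells_vhom(1)[OF phi]] by simp
  have q: "q \<in> vhom K (vcod K j) (pend K P)"
    using cells_vhom(2)[OF x] c by (simp add: pend_def)
  note q' = vidcell_cells[OF q]
  have xe: "\<chi> \<star> [\<eta>] \<in> cells K (vdom K j, []) P p (q \<cdot> j)"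
    using ccomp1_cells[OF eta' x] vcomp_vid[OF cells_vhom(1)[OF x]] by simp
  have qe: "vidcell K q \<star> [\<epsilon>] \<in> cells K (vdom K j, [J]) (pend K P, []) (q \<cdot> j) q"
    using ccomp1_cells[OF c(7) q'] vcomp_vid[OF q] by simp
  \<comment> \<open>The left factor has empty horizontal source, so it needs a cell of its own: the
    vertical identity cell of \<open>h\<close>, put in front of \<open>\<phi>\<close>.\<close>
  have "\<chi> \<star> [\<phi>] = (pathid K P \<star> [\<chi> \<star> [\<eta>], vidcell K q \<star> [\<epsilon>]]) \<star> [vidcell K h, \<phi>]"
    using companion_decomposition[OF comp eta x] insert_id_left[OF phi x] by simp
  also have "\<dots> = pathid K P \<star> [(\<chi> \<star> [\<eta>]) \<star> [vidcell K h], (vidcell K q \<star> [\<epsilon>]) \<star> [\<phi>]]"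
    using ccomp_assoc22[OF h phi xe qe pathid_cells[OF P] pcP] by simp
  also have "\<dots> = pathid K P \<star> [(\<chi> \<star> [\<eta>]) \<star> [vidcell K h], vidcell K q \<star> [\<epsilon> \<star> [\<phi>]]]"
    using ccomp_assoc11[OF phi c(7) q'] by simp
  also have "\<dots> = whisker_right K (\<chi> \<star> [\<eta>]) h \<odot> whisker_left K q (\<epsilon> \<star> [\<phi>])"
    using hcomp_cells[OF ccomp1_cells[OF h xe] ccomp1_cells[OF ccomp1_cells[OF phi c(7)] q']] pcP
    by (simp add: whisker_right_def whisker_left_def)
  finally show ?thesis .
qed

end

theorem lemma5p17:
  fixes K :: "('o, 'v, 'h, 'c) avdc" (structure)
  assumes "augmented_virtual_double_category K"
    and "j \<in> vhom K A B" and "f \<in> vhom K A C" and "g \<in> vhom K B C"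
    and "is_companion K j J \<epsilon>" and "is_companion_cell K j J \<epsilon> \<eta>"
    and "\<psi> \<in> vcells K f (g \<cdot> j)"
    and "\<psi>' \<in> cells K (A, [J]) (C, []) f g" and "\<psi> = \<psi>' \<star> [\<eta>]"
    and "cartesian K \<psi>'"
  shows "absolute_left_lifting K f g j \<psi>"
proof -
  interpret augmented_virtual_double_category K by fact
  note c = companion_facts[OF assms(5)]
  have j: "vdom K j = A" "vcod K j = B"
    using assms(2) by (auto simp: vhom_def)
  have psi': "\<psi>' \<in> cells K (vdom K j, [J]) (C, []) f g"
    using assms(8) j by simp
  have "\<exists>!\<xi>. \<xi> \<in> vcells K (j \<cdot> h) k \<and> \<chi> = whisker_right K \<psi> h \<odot> whisker_left K g \<xi>"
    if h: "h \<in> vhom K X (vdom K j)" and k: "k \<in> vhom K X (vcod K j)"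
      and x: "\<chi> \<in> vcells K (f \<cdot> h) (g \<cdot> k)" for X h k \<chi>
  proof -
    \<comment> \<open>\<open>vcells\<close> takes its end objects from its first vertical morphism
      only.\<close>
    have "vdom K (f \<cdot> h) = X" "vcod K (f \<cdot> h) = C" "vdom K (j \<cdot> h) = X" "vcod K (j \<cdot> h) = B"
      using vcomp_vhom[OF h] assms(2,3) j by (auto simp: vhom_def)
    then have vc: "vcells K (f \<cdot> h) m = cells K (X, []) (C, []) (f \<cdot> h) m"
      "vcells K (j \<cdot> h) m = cells K (X, []) (vcod K j, []) (j \<cdot> h) m" for m
      using j by (simp_all add: vcells_def)
    \<comment> \<open>The vertical target of \<open>\<epsilon>\<close> is an identity, so
      cartesianness of \<open>\<epsilon>\<close> speaks of cells with vertical target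
      \<open>vid K (vcod K j) \<cdot> k\<close>.\<close>
    have idk: "vid K (vcod K j) \<cdot> k = k"
      by (rule vid_vcomp[OF k])
    have X: "is_hpath K (X, [])"
      using h vdom_Obj by (auto simp: is_hpath_def vhom_def)
    \<comment> \<open>Both cartesian cells have the same horizontal source, so \<open>h\<close> and
      \<open>k\<close> fit either one.\<close>
    have hk: "h \<in> vhom K (pstart (X, [])) (pstart (vdom K j, [J]))"
      "k \<in> vhom K (pend K (X, [])) (pend K (vdom K j, [J]))"
      using h k c(6) by (simp_all add: pstart_def pend_def)
    have ex_psi: "\<exists>!\<phi>. \<phi> \<in> cells K (X, []) (vdom K j, [J]) h k \<and> \<chi> = \<psi>' \<star> [\<phi>]"
      using cartesian_ex1[OF assms(10) psi' X hk] x vc by simp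
    have ex_eps: "\<exists>!\<phi>. \<phi> \<in> cells K (X, []) (vdom K j, [J]) h k \<and> \<xi> = \<epsilon> \<star> [\<phi>]"
      if "\<xi> \<in> vcells K (j \<cdot> h) k" for \<xi>
      using cartesian_ex1[OF c(8,7) X hk] that vc idk by simp
    have comp: "\<psi>' \<star> [\<phi>] = whisker_right K \<psi> h \<odot> whisker_left K g (\<epsilon> \<star> [\<phi>])"
      if "\<phi> \<in> cells K (X, []) (vdom K j, [J]) h k" for \<phi>
      using ccomp_companion_decomposition[OF assms(5,6) psi' that] assms(9) by simp
    from ex_psi obtain \<phi> where phi: "\<phi> \<in> cells K (X, []) (vdom K j, [J]) h k" "\<chi> = \<psi>' \<star> [\<phi>]"
      by blast
    show ?thesis
    proof (rule ex1I[of _ "\<epsilon> \<star> [\<phi>]"])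
      show "\<epsilon> \<star> [\<phi>] \<in> vcells K (j \<cdot> h) k \<and>
          \<chi> = whisker_right K \<psi> h \<odot> whisker_left K g (\<epsilon> \<star> [\<phi>])"
        using ccomp1_cells[OF phi(1) c(7)] vc idk comp[OF phi(1)] phi(2) by simp
    next
      fix \<xi>
      assume xi: "\<xi> \<in> vcells K (j \<cdot> h) k \<and> \<chi> = whisker_right K \<psi> h \<odot> whisker_left K g \<xi>"
      \<comment> \<open>A competing \<open>\<xi>\<close> is lifted through
        \<open>\<epsilon>\<close>; its lift \<open>\<phi>'\<close> also factors
        \<open>\<chi>\<close> through \<open>\<psi>'\<close>, so it equals
        \<open>\<phi>\<close>.\<close>
      with ex_eps obtain \<phi>' where
        phi': "\<phi>' \<in> cells K (X, []) (vdom K j, [J]) h k" "\<xi> = \<epsilon> \<star> [\<phi>']"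
        by blast
      then have "\<chi> = \<psi>' \<star> [\<phi>']"
        using comp xi by simp
      then show "\<xi> = \<epsilon> \<star> [\<phi>]"
        using ex_psi phi phi' by blast
    qed
  qed
  with assms(7) show ?thesis
    unfolding absolute_left_lifting_def by blast
qed

end
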